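(* Let $n\geq 3$ be an even integer and let $k$ be an integer with $1\leq k<n/2$. The generalized Tutte-Coxeter graph $TC(n,k)$ is edge-transitive if and only if $(n,k)=(10,3)$.
   Context: For an even integer $n\geq 3$ and an integer $1\leq k<n/2$, the generalized Tutte-Coxeter graph $TC(n,k)$ is the graph on the $3n$ vertices $a_0,\ldots,a_{n-1},b_0,\ldots,b_{n-1},c_0,\ldots,c_{n-1}$ whose edges are $\{a_i,a_{i+1}\}$, $\{a_i,b_i\}$, $\{b_i,b_{i+n/2}\}$, $\{b_i,c_i\}$ and $\{c_i,c_{i+k}\}$ for all $i$, with all indices taken modulo $n$. A graph is edge-transitive if its automorphism group acts transitively on its edges. *)

theory Defs
  imports Main
begin

text \<open>
  A finite simple graph is given by its vertex set \<open>V\<close> and its set \<open>E\<close> of edges, each edge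
  being the two-element set of its end vertices.
\<close>

definition graph_automorphism :: "'v set \<Rightarrow> 'v set set \<Rightarrow> ('v \<Rightarrow> 'v) \<Rightarrow> bool" where
  "graph_automorphism V E f \<longleftrightarrow>
     bij_betw f V V \<and> (\<forall>u\<in>V. \<forall>v\<in>V. {u, v} \<in> E \<longleftrightarrow> {f u, f v} \<in> E)"

definition edge_transitive :: "'v set \<Rightarrow> 'v set set \<Rightarrow> bool" where
  "edge_transitive V E \<longleftrightarrow>
     (\<forall>e\<in>E. \<forall>e'\<in>E. \<exists>f. graph_automorphism V E f \<and> f ` e = e')"

datatype tc_vertex = A nat | B nat | C nat

definition TC_verts :: "nat \<Rightarrow> tc_vertex set" where
  "TC_verts n = A ` {..<n} \<union> B ` {..<n} \<union> C ` {..<n}"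

definition TC_edges :: "nat \<Rightarrow> nat \<Rightarrow> tc_vertex set set" where
  "TC_edges n k =
     {{A i, A ((i + 1) mod n)} | i. i < n} \<union>
     {{A i, B i} | i. i < n} \<union>
     {{B i, B ((i + n div 2) mod n)} | i. i < n} \<union>
     {{B i, C i} | i. i < n} \<union>
     {{C i, C ((i + k) mod n)} | i. i < n}"

text \<open>
  For even \<open>n \<ge> 3\<close> and \<open>1 \<le> k < n/2\<close> all the edges are two-element sets. Each edge
  \<open>{B i, B (i + n/2)}\<close> is listed twice in the comprehension, so there are only \<open>n/2\<close> of them.
\<close>

end

(*
  The number of closed non-backtracking walks of length 8 through an edge is invariant under
  automorphisms. TC(n,k) is a Z_n-cover of a graph on three vertices, so these walks are the closed
  words in the darts of the quotient whose index shift a + b n/2 + c k vanishes modulo n. Equal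
  counts on the edges {A i, A (i+1)} and {B i, B (i+n/2)} force k = 3 or n <= 10; comparing with
  the edges {C i, C (i+k)} then leaves only (10,3). For (10,3) the rotation and one automorphism
  that shifts a 5-arc through all five edge families generate a group transitive on the edges.
*)

theory Submission
  imports Defs
begin

section \<open>Closed non-backtracking walks\<close>

definition nbrs :: "'v set \<Rightarrow> 'v set set \<Rightarrow> 'v \<Rightarrow> 'v set" where
  "nbrs V E v = {w \<in> V. {v, w} \<in> E}"

text \<open>
  The number of ways to continue the step from \<open>u\<close> to \<open>v\<close> by \<open>L\<close> further steps without
  backtracking, the last of these being the step from \<open>x\<close> to \<open>y\<close>.
\<close>

fun nb_walks :: "'v set \<Rightarrow> 'v set set \<Rightarrow> nat \<Rightarrow> 'v \<Rightarrow> 'v \<Rightarrow> 'v \<Rightarrow> 'v \<Rightarrow> nat" where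
  "nb_walks V E 0 u v x y = (if u = x \<and> v = y then 1 else 0)"
| "nb_walks V E (Suc L) u v x y = (\<Sum>w\<in>nbrs V E v - {u}. nb_walks V E L v w x y)"

lemma nbrs_automorphism:
  assumes f: "graph_automorphism V E f" and v: "v \<in> V"
  shows "nbrs V E (f v) = f ` nbrs V E v"
proof -
  have im: "f ` V = V" using f by (auto simp: graph_automorphism_def bij_betw_def)
  have "w \<in> f ` nbrs V E v" if w: "w \<in> nbrs V E (f v)" for w
  proof -
    obtain z where "z \<in> V" "w = f z" using w im by (auto simp: nbrs_def)
    then show ?thesis using w f v by (auto simp: nbrs_def graph_automorphism_def)
  qed
  moreover have "f z \<in> nbrs V E (f v)" if "z \<in> nbrs V E v" for z
    using that f v im by (auto simp: nbrs_def graph_automorphism_def)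
  ultimately show ?thesis by blast
qed

text \<open>An automorphism carries the admissible next vertices, the neighbours of \<open>v\<close>
  other than \<open>u\<close>, bijectively onto those of the image step, so the recursion gives
  equal sums.\<close>

lemma nb_walks_automorphism:
  assumes f: "graph_automorphism V E f" and "u \<in> V" "v \<in> V" "x \<in> V" "y \<in> V"
  shows "nb_walks V E L (f u) (f v) (f x) (f y) = nb_walks V E L u v x y"
  using assms(2-3)
proof (induction L arbitrary: u v)
  case 0
  have "inj_on f V" using f by (auto simp: graph_automorphism_def bij_betw_def)
  then show ?case using 0 assms(4,5) by (simp add: inj_on_eq_iff)
next
  case (Suc L)
  have inj: "inj_on f V" using f by (auto simp: graph_automorphism_def bij_betw_def)
  have sub: "nbrs V E v - {u} \<subseteq> V" by (auto simp: nbrs_def)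
  have "nbrs V E (f v) - {f u} = f ` (nbrs V E v - {u})"
    using Suc.prems inj
    by (subst nbrs_automorphism[OF f], simp, subst inj_on_image_set_diff[of f V]) (auto simp: nbrs_def)
  then have "nb_walks V E (Suc L) (f u) (f v) (f x) (f y)
      = (\<Sum>w\<in>nbrs V E v - {u}. nb_walks V E L (f v) (f w) (f x) (f y))"
    using sum.reindex[OF inj_on_subset[OF inj sub], of "\<lambda>w. nb_walks V E L (f v) w (f x) (f y)"]
    by simp
  also have "\<dots> = nb_walks V E (Suc L) u v x y"
    using Suc sub by (auto intro!: sum.cong)
  finally show ?case .
qed

text \<open>The automorphism taking one edge to the other may reverse it, hence the two
  alternatives. With equal first and last steps \<open>nb_walks\<close> counts closed walks that do
  not backtrack at the closing point either.\<close>

lemma edge_transitive_nb_walks: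
  assumes "edge_transitive V E" "{u, v} \<in> E" "{x, y} \<in> E" "u \<in> V" "v \<in> V"
  shows "nb_walks V E L x y x y = nb_walks V E L u v u v \<or>
    nb_walks V E L y x y x = nb_walks V E L u v u v"
proof -
  obtain f where f: "graph_automorphism V E f" "f ` {u, v} = {x, y}"
    using assms unfolding edge_transitive_def by blast
  then have "f u = x \<and> f v = y \<or> f u = y \<and> f v = x"
    by (auto simp: doubleton_eq_iff)
  then show ?thesis
    using nb_walks_automorphism[OF f(1) assms(4,5,4,5), of L] by auto
qed

section \<open>Walks as words in the quotient graph\<close>

text \<open>Integer indices allow negative shifts and turn every equality of vertices of one kind
  into divisibility of a difference by \<open>n\<close>.\<close>

definition vA :: "nat \<Rightarrow> int \<Rightarrow> tc_vertex" where "vA n x = A (nat (x mod int n))"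
definition vB :: "nat \<Rightarrow> int \<Rightarrow> tc_vertex" where "vB n x = B (nat (x mod int n))"
definition vC :: "nat \<Rightarrow> int \<Rightarrow> tc_vertex" where "vC n x = C (nat (x mod int n))"

lemmas vABC_defs = vA_def vB_def vC_def

lemma nat_mod_eq_iff:
  "0 < n \<Longrightarrow> nat (x mod int n) = nat (y mod int n) \<longleftrightarrow> int n dvd x - y"
  by (simp add: mod_eq_dvd_iff[symmetric] eq_nat_nat_iff)

lemma vABC_eq_iff:
  assumes "0 < n"
  shows "vA n x = vA n y \<longleftrightarrow> int n dvd x - y" "vB n x = vB n y \<longleftrightarrow> int n dvd x - y"
    "vC n x = vC n y \<longleftrightarrow> int n dvd x - y"
  using assms by (simp_all add: vABC_defs nat_mod_eq_iff)

lemma vABC_distinct: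
  "vA n x \<noteq> vB n y" "vB n y \<noteq> vA n x" "vA n x \<noteq> vC n y" "vC n y \<noteq> vA n x"
  "vB n x \<noteq> vC n y" "vC n y \<noteq> vB n x"
  by (simp_all add: vABC_defs)

lemma vABC_nat:
  assumes "i < n"
  shows "A i = vA n (int i)" "B i = vB n (int i)" "C i = vC n (int i)"
    "A ((i + j) mod n) = vA n (int i + int j)" "B ((i + j) mod n) = vB n (int i + int j)"
    "C ((i + j) mod n) = vC n (int i + int j)"
  using assms by (simp_all add: vABC_defs nat_mod_distrib flip: of_nat_add of_nat_mod)

lemma vABC_in_verts:
  assumes "0 < n"
  shows "vA n x \<in> TC_verts n" "vB n x \<in> TC_verts n" "vC n x \<in> TC_verts n"
proof -
  have "nat (x mod int n) < n" using assms by (simp add: nat_less_iff)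
  then show "vA n x \<in> TC_verts n" "vB n x \<in> TC_verts n" "vC n x \<in> TC_verts n"
    by (auto simp: TC_verts_def vABC_defs)
qed

lemma TC_verts_cases:
  assumes "w \<in> TC_verts n"
  obtains y where "w = vA n y" | y where "w = vB n y" | y where "w = vC n y"
  using assms vABC_nat(1-3) unfolding TC_verts_def by blast

text \<open>Both vertex maps are \<open>n\<close>-periodic, so letting the index run over all
  integers adds no edge. This removes \<open>mod\<close> from the edge families.\<close>

lemma shift_family_eq:
  assumes n: "0 < n"
    and f: "\<And>x y. int n dvd x - y \<Longrightarrow> f x = f y" and g: "\<And>x y. int n dvd x - y \<Longrightarrow> g x = g y"
  shows "{{f (int i), g (int i + j)} |i. i < n} = {{f x, g (x + j)} |x. True}"
proof -
  have "\<exists>i<n. {f x, g (x + j)} = {f (int i), g (int i + j)}" for x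
  proof (intro exI[of _ "nat (x mod int n)"] conjI)
    show "nat (x mod int n) < n" using n by (simp add: nat_less_iff)
    have "int n dvd x - int (nat (x mod int n))" using n by simp
    moreover from this have "int n dvd (x + j) - (int (nat (x mod int n)) + j)" by simp
    ultimately show "{f x, g (x + j)}
        = {f (int (nat (x mod int n))), g (int (nat (x mod int n)) + j)}"
      using f g by metis
  qed
  then show ?thesis by (auto; blast)
qed

lemma TC_edges_int:
  assumes "0 < n"
  shows "TC_edges n k =
     {{vA n x, vA n (x + 1)} |x. True} \<union> {{vA n x, vB n (x + 0)} |x. True} \<union>
     {{vB n x, vB n (x + int (n div 2))} |x. True} \<union> {{vB n x, vC n (x + 0)} |x. True} \<union>
     {{vC n x, vC n (x + int k)} |x. True}"
proof -
  have e: "{h i |i. i < n} = {h' i |i. i < n}"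
    if "\<And>i. i < n \<Longrightarrow> h i = h' i" for h h' :: "nat \<Rightarrow> tc_vertex set"
    using that by auto
  have "{{A i, A ((i + 1) mod n)} |i. i < n} = {{vA n (int i), vA n (int i + 1)} |i. i < n}"
    by (rule e) (metis vABC_nat(1) vABC_nat(4) of_nat_1)
  moreover have "{{A i, B i} |i. i < n} = {{vA n (int i), vB n (int i + 0)} |i. i < n}"
    by (rule e) (simp add: vABC_nat)
  moreover have "{{B i, B ((i + n div 2) mod n)} |i. i < n}
      = {{vB n (int i), vB n (int i + int (n div 2))} |i. i < n}"
    by (rule e) (metis vABC_nat(2) vABC_nat(5))
  moreover have "{{B i, C i} |i. i < n} = {{vB n (int i), vC n (int i + 0)} |i. i < n}"
    by (rule e) (simp add: vABC_nat)
  moreover have "{{C i, C ((i + k) mod n)} |i. i < n}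
      = {{vC n (int i), vC n (int i + int k)} |i. i < n}"
    by (rule e) (metis vABC_nat(3) vABC_nat(6))
  ultimately show ?thesis
    unfolding TC_edges_def
    by (simp only: shift_family_eq[OF assms] vABC_eq_iff[OF assms])
qed

lemma TC_adjacency:
  assumes n: "0 < n" "even n"
  shows "{vA n x, vA n y} \<in> TC_edges n k \<longleftrightarrow> int n dvd y - (x + 1) \<or> int n dvd y - (x - 1)"
    "{vA n x, vB n y} \<in> TC_edges n k \<longleftrightarrow> int n dvd y - x"
    "{vB n x, vA n y} \<in> TC_edges n k \<longleftrightarrow> int n dvd y - x"
    "{vA n x, vC n y} \<notin> TC_edges n k" "{vC n x, vA n y} \<notin> TC_edges n k"
    "{vB n x, vB n y} \<in> TC_edges n k \<longleftrightarrow> int n dvd y - (x + int (n div 2))"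
    "{vB n x, vC n y} \<in> TC_edges n k \<longleftrightarrow> int n dvd y - x"
    "{vC n x, vB n y} \<in> TC_edges n k \<longleftrightarrow> int n dvd y - x"
    "{vC n x, vC n y} \<in> TC_edges n k \<longleftrightarrow> int n dvd y - (x + int k) \<or> int n dvd y - (x - int k)"
proof -
  note s = TC_edges_int[OF n(1)] doubleton_eq_iff vABC_eq_iff[OF n(1)] vABC_distinct
  have sym: "int n dvd a - b \<longleftrightarrow> int n dvd b - a" for a b by (rule dvd_diff_commute)
  have tr: "int n dvd a - c" if "int n dvd a - b" "int n dvd b - c" for a b c
    using dvd_add[OF that] by simp
  \<comment> \<open>An unordered pair can match an edge of the family in two orders, which yields
    the shifts \<open>+j\<close> and \<open>-j\<close>; the variable \<open>z\<close> is eliminated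
    by subtracting the congruences.\<close>
  have step: "(\<exists>z. int n dvd x - z \<and> int n dvd y - (z + j) \<or> int n dvd x - (z + j) \<and> int n dvd y - z)
      \<longleftrightarrow> int n dvd y - (x + j) \<or> int n dvd y - (x - j)" (is "?l \<longleftrightarrow> ?r") for j
  proof
    assume ?l
    then obtain z where "int n dvd x - z \<and> int n dvd y - (z + j)
      \<or> int n dvd x - (z + j) \<and> int n dvd y - z" by blast
    then show ?r
    proof
      assume "int n dvd x - z \<and> int n dvd y - (z + j)"
      then have "int n dvd (y - (z + j)) - (x - z)" by (blast intro: dvd_diff)
      then show ?r by (simp add: algebra_simps)
    next
      assume "int n dvd x - (z + j) \<and> int n dvd y - z"
      then have "int n dvd (y - z) - (x - (z + j))" by (blast intro: dvd_diff)
      then show ?r by (simp add: algebra_simps)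
    qed
  next
    assume ?r
    then show ?l
    proof
      assume "int n dvd y - (x + j)" then show ?l by (intro exI[of _ x]) simp
    next
      assume "int n dvd y - (x - j)" then show ?l by (intro exI[of _ "x - j"]) simp
    qed
  qed
  have one: "(\<exists>z. int n dvd x - z \<and> int n dvd y - z) \<longleftrightarrow> int n dvd y - x" for x y
    using sym tr by (metis diff_self dvd_0_right)
  \<comment> \<open>The shifts by \<open>n/2\<close> and \<open>-n/2\<close> differ by
    \<open>n\<close>, so a \<open>B\<close> vertex has a single neighbour of kind
    \<open>B\<close>.\<close>
  have half: "int n dvd y - (x - int (n div 2)) \<longleftrightarrow> int n dvd y - (x + int (n div 2))"
  proof -
    have "y - (x - int (n div 2)) = y - (x + int (n div 2)) + int n"
      using n(2) by auto
    then show ?thesis by (metis dvd_add_triv_right_iff)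
  qed
  show "{vA n x, vA n y} \<in> TC_edges n k \<longleftrightarrow> int n dvd y - (x + 1) \<or> int n dvd y - (x - 1)"
    using step[of 1] by (simp add: s)
  show "{vB n x, vB n y} \<in> TC_edges n k \<longleftrightarrow> int n dvd y - (x + int (n div 2))"
    using step[of "int (n div 2)"] half by (simp add: s)
  show "{vC n x, vC n y} \<in> TC_edges n k \<longleftrightarrow> int n dvd y - (x + int k) \<or> int n dvd y - (x - int k)"
    using step[of "int k"] by (simp add: s)
  show "{vA n x, vB n y} \<in> TC_edges n k \<longleftrightarrow> int n dvd y - x"
    "{vB n x, vC n y} \<in> TC_edges n k \<longleftrightarrow> int n dvd y - x"
    using one[of x y] by (simp_all add: s)
  show "{vB n x, vA n y} \<in> TC_edges n k \<longleftrightarrow> int n dvd y - x"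
    "{vC n x, vB n y} \<in> TC_edges n k \<longleftrightarrow> int n dvd y - x"
    using one[of y x] by (simp_all add: s sym conj_commute)
  show "{vA n x, vC n y} \<notin> TC_edges n k" "{vC n x, vA n y} \<notin> TC_edges n k"
    by (simp_all add: s)
qed

lemma nbrs_TC:
  assumes n: "0 < n" "even n"
  shows "nbrs (TC_verts n) (TC_edges n k) (vA n x) = {vA n (x + 1), vA n (x - 1), vB n x}"
    "nbrs (TC_verts n) (TC_edges n k) (vB n x) = {vA n x, vB n (x + int (n div 2)), vC n x}"
    "nbrs (TC_verts n) (TC_edges n k) (vC n x) = {vC n (x + int k), vC n (x - int k), vB n x}"
  by (auto simp: nbrs_def TC_adjacency[OF n] vABC_eq_iff[OF n(1)] vABC_distinct
      vABC_in_verts[OF n(1)] elim!: TC_verts_cases)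

section \<open>Darts of the three-vertex quotient and the lifting of its words\<close>

datatype dart = AFwd | ABwd | AtoB | BtoA | BtoB | BtoC | CtoB | CFwd | CBwd

text \<open>The loops at \<open>A\<close> and \<open>C\<close> have two darts each. The loop at
  \<open>B\<close> is a semi-edge: \<open>BtoB\<close> is its own reverse, so it must not follow
  itself.\<close>

fun continuations :: "dart \<Rightarrow> dart list" where
  "continuations AFwd = [AFwd, AtoB]"
| "continuations ABwd = [ABwd, AtoB]"
| "continuations AtoB = [BtoB, BtoC]"
| "continuations BtoA = [AFwd, ABwd]"
| "continuations BtoB = [BtoA, BtoC]"
| "continuations BtoC = [CFwd, CBwd]"
| "continuations CtoB = [BtoA, BtoB]"
| "continuations CFwd = [CFwd, CtoB]"
| "continuations CBwd = [CBwd, CtoB]"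

text \<open>The triple \<open>(a, b, c)\<close> stands for the index shift \<open>a + b * (n / 2) + c * k\<close>.\<close>

fun shift :: "dart \<Rightarrow> int \<times> int \<times> int" where
  "shift AFwd = (1, 0, 0)"
| "shift ABwd = (-1, 0, 0)"
| "shift BtoB = (0, 1, 0)"
| "shift CFwd = (0, 0, 1)"
| "shift CBwd = (0, 0, -1)"
| "shift AtoB = (0, 0, 0)"
| "shift BtoA = (0, 0, 0)"
| "shift BtoC = (0, 0, 0)"
| "shift CtoB = (0, 0, 0)"

fun add_shift :: "int \<times> int \<times> int \<Rightarrow> int \<times> int \<times> int \<Rightarrow> int \<times> int \<times> int" where
  "add_shift (a, b, c) (a', b', c') = (a + a', b + b', c + c')"

fun shift_value :: "nat \<Rightarrow> nat \<Rightarrow> int \<times> int \<times> int \<Rightarrow> int" where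
  "shift_value n k (a, b, c) = a + b * int (n div 2) + c * int k"

lemma shift_value_add: "shift_value n k (add_shift s t) = shift_value n k s + shift_value n k t"
  by (cases s; cases t) (simp add: algebra_simps)

text \<open>Total shifts, with multiplicity, of the non-backtracking words that follow
  \<open>d\<close> and end in \<open>d'\<close>; the shift of the initial \<open>d\<close> itself is
  not counted. Formal triples make these lists independent of \<open>n\<close> and
  \<open>k\<close>.\<close>

fun words :: "nat \<Rightarrow> dart \<Rightarrow> dart \<Rightarrow> (int \<times> int \<times> int) list" where
  "words 0 d d' = (if d = d' then [(0, 0, 0)] else [])"
| "words (Suc L) d d' =
    concat (map (\<lambda>e. map (add_shift (shift e)) (words L e d')) (continuations d))"

fun dart_head :: "nat \<Rightarrow> dart \<Rightarrow> int \<Rightarrow> tc_vertex" where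
  "dart_head n AFwd x = vA n x"
| "dart_head n ABwd x = vA n x"
| "dart_head n AtoB x = vB n x"
| "dart_head n BtoA x = vA n x"
| "dart_head n BtoB x = vB n x"
| "dart_head n BtoC x = vC n x"
| "dart_head n CtoB x = vB n x"
| "dart_head n CFwd x = vC n x"
| "dart_head n CBwd x = vC n x"

text \<open>The index \<open>x\<close> is that of the head of the lifted dart, so the tail is found
  by subtracting the shift.\<close>

fun dart_tail :: "nat \<Rightarrow> nat \<Rightarrow> dart \<Rightarrow> int \<Rightarrow> tc_vertex" where
  "dart_tail n k AFwd x = vA n (x - 1)"
| "dart_tail n k ABwd x = vA n (x + 1)"
| "dart_tail n k AtoB x = vA n x"
| "dart_tail n k BtoA x = vB n x"
| "dart_tail n k BtoB x = vB n (x - int (n div 2))"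
| "dart_tail n k BtoC x = vB n x"
| "dart_tail n k CtoB x = vC n x"
| "dart_tail n k CFwd x = vC n (x - int k)"
| "dart_tail n k CBwd x = vC n (x + int k)"

text \<open>The only danger is confusing the two directions of a loop at \<open>A\<close> or
  \<open>C\<close>: their tails over a common head differ by 2 or \<open>2 * k\<close>, and
  \<open>n\<close> divides neither.\<close>

lemma dart_eq_iff:
  assumes n: "3 \<le> n" "1 \<le> k" "2 * k < n"
  shows "dart_tail n k d x = dart_tail n k d' y \<and> dart_head n d x = dart_head n d' y
    \<longleftrightarrow> d = d' \<and> int n dvd x - y"
proof (cases "int n dvd x - y")
  case True
  have n0: "0 < n" using n by simp
  have two: "\<not> int n dvd 2" using n zdvd_imp_le[of "int n" 2] by auto
  have two_k: "\<not> int n dvd 2 * int k" using n zdvd_imp_le[of "int n" "2 * int k"] by auto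
  have shifted: "\<not> int n dvd z" if "z = x - y + t \<or> z = x - y - t" "\<not> int n dvd t" for z t
    using that True by (metis add_diff_cancel_left' diff_diff_eq2 dvd_diff)
  have "\<not> int n dvd x - 1 - (y + 1)" "\<not> int n dvd x + 1 - (y - 1)"
    by (rule shifted[OF _ two], simp)+
  moreover have "\<not> int n dvd x - int k - (y + int k)" "\<not> int n dvd x + int k - (y - int k)"
    by (rule shifted[OF _ two_k], simp)+
  ultimately show ?thesis
    using True by (cases d; cases d') (simp_all add: vABC_eq_iff[OF n0] vABC_distinct)
next
  case False
  then show ?thesis
    using n by (cases d; cases d') (auto simp: vABC_eq_iff vABC_distinct)
qed

lemma dart_tail_continuation:
  assumes "e \<in> set (continuations d)"
  shows "dart_tail n k e (x + shift_value n k (shift e)) = dart_head n d x"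
  using assms by (cases d) auto

text \<open>This is the covering property: locally, non-backtracking steps upstairs correspond one
  to one to continuations in the quotient.\<close>

lemma nbrs_dart_head:
  assumes n: "3 \<le> n" "even n" "1 \<le> k" "2 * k < n"
  shows "nbrs (TC_verts n) (TC_edges n k) (dart_head n d x) - {dart_tail n k d x}
    = (\<lambda>e. dart_head n e (x + shift_value n k (shift e))) ` set (continuations d)"
    and "inj_on (\<lambda>e. dart_head n e (x + shift_value n k (shift e))) (set (continuations d))"
proof -
  have n0: "0 < n" using n by simp
  have two: "\<not> int n dvd 2" using n zdvd_imp_le[of "int n" 2] by auto
  have two_k: "\<not> int n dvd 2 * int k" using n zdvd_imp_le[of "int n" "2 * int k"] by auto
  have d1: "\<not> int n dvd x + 1 - (x - 1)" "\<not> int n dvd x - 1 - (x + 1)"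
    using two dvd_minus_iff[of "int n" 2] by simp_all
  have d2: "\<not> int n dvd x + int k - (x - int k)" "\<not> int n dvd x - int k - (x + int k)"
  proof -
    have "x + int k - (x - int k) = 2 * int k" "x - int k - (x + int k) = - (2 * int k)" by simp_all
    then show "\<not> int n dvd x + int k - (x - int k)" "\<not> int n dvd x - int k - (x + int k)"
      using two_k by simp_all
  qed
  have "x + int (n div 2) = x - int (n div 2) + int n" using n(2) by auto
  then have half: "vB n (x + int (n div 2)) = vB n (x - int (n div 2))"
    by (metis vB_def mod_add_self2)
  note ne = vABC_eq_iff[OF n0] vABC_distinct two two_k d1 d2
  show "nbrs (TC_verts n) (TC_edges n k) (dart_head n d x) - {dart_tail n k d x}
    = (\<lambda>e. dart_head n e (x + shift_value n k (shift e))) ` set (continuations d)"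
    by (cases d) (simp_all add: nbrs_TC[OF n0 n(2)] half insert_Diff_if ne insert_commute)
  show "inj_on (\<lambda>e. dart_head n e (x + shift_value n k (shift e))) (set (continuations d))"
    by (cases d) (simp_all add: ne)
qed

text \<open>By unique lifting, each word gives one walk from the chosen start, and it ends at the
  prescribed step exactly when its shift takes \<open>x\<close> to \<open>y\<close> modulo
  \<open>n\<close>.\<close>

lemma nb_walks_TC:
  assumes n: "3 \<le> n" "even n" "1 \<le> k" "2 * k < n"
  shows "nb_walks (TC_verts n) (TC_edges n k) L
      (dart_tail n k d x) (dart_head n d x) (dart_tail n k d' y) (dart_head n d' y)
    = (\<Sum>s\<leftarrow>words L d d'. of_bool (int n dvd x + shift_value n k s - y))"
proof (induction L arbitrary: d x)
  case 0
  then show ?case using dart_eq_iff[OF n(1,3,4), of d x d' y] by auto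
next
  case (Suc L)
  let ?x = "\<lambda>e. x + shift_value n k (shift e)"
  have "nb_walks (TC_verts n) (TC_edges n k) (Suc L)
      (dart_tail n k d x) (dart_head n d x) (dart_tail n k d' y) (dart_head n d' y)
    = (\<Sum>e\<in>set (continuations d). nb_walks (TC_verts n) (TC_edges n k) L
      (dart_head n d x) (dart_head n e (?x e)) (dart_tail n k d' y) (dart_head n d' y))"
    by (simp add: nbrs_dart_head(1)[OF n] sum.reindex[OF nbrs_dart_head(2)[OF n]])
  also have "\<dots> = (\<Sum>e\<in>set (continuations d).
      \<Sum>s\<leftarrow>words L e d'. of_bool (int n dvd ?x e + shift_value n k s - y))"
  proof (rule sum.cong[OF refl])
    fix e assume "e \<in> set (continuations d)"
    then show "nb_walks (TC_verts n) (TC_edges n k) L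
        (dart_head n d x) (dart_head n e (?x e)) (dart_tail n k d' y) (dart_head n d' y)
      = (\<Sum>s\<leftarrow>words L e d'. of_bool (int n dvd ?x e + shift_value n k s - y))"
      using Suc[of e "?x e"] by (simp only: dart_tail_continuation)
  qed
  also have "\<dots> = (\<Sum>e\<leftarrow>continuations d.
      \<Sum>s\<leftarrow>words L e d'. of_bool (int n dvd ?x e + shift_value n k s - y))"
    by (rule sum_list_distinct_conv_sum_set[symmetric]) (cases d; simp)
  also have "\<dots> = (\<Sum>s\<leftarrow>words (Suc L) d d'. of_bool (int n dvd x + shift_value n k s - y))"
    by (cases d) (simp_all add: shift_value_add o_def add.assoc)
  finally show ?case .
qed

section \<open>Counting closed walks of length 8\<close>

text \<open>Length 8 is the girth of the Tutte-Coxeter graph. The shift \<open>(0, 2, 0)\<close>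
  closes for every \<open>n\<close>; it occurs four times for \<open>BtoB\<close> but only once for
  each of \<open>AFwd\<close> and \<open>CFwd\<close>, and this imbalance drives the
  argument.\<close>

lemma words_8:
  shows "words 8 AFwd AFwd =
    [(8, 0, 0), (5, 1, 0), (5, 1, 0), (5, 1, 0), (3, 0, 1), (3, 0, -1), (5, 1, 0), (2, 1, 1),
     (2, 1, -1), (2, 0, 2), (3, 0, 1), (2, 1, 1), (2, 0, -2), (3, 0, -1), (2, 1, -1), (5, 1,
     0), (2, 2, 0), (0, 2, 0), (1, 1, 2), (2, 1, 1), (1, 2, 1), (1, 1, -2), (2, 1, -1), (1, 2,
     -1), (1, 0, 3), (2, 0, 2), (1, 1, 2), (3, 0, 1), (2, 1, 1), (1, 0, -3), (2, 0, -2), (1, 1,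
     -2), (3, 0, -1), (2, 1, -1)]"
  and "words 8 BtoB BtoB =
    [(5, 1, 0), (2, 1, 1), (2, 1, -1), (2, 2, 0), (0, 2, 0), (1, 2, 1), (1, 2, -1), (1, 1, 2),
     (1, 1, -2), (-5, 1, 0), (-2, 1, 1), (-2, 1, -1), (0, 2, 0), (-2, 2, 0), (-1, 2, 1), (-1,
     2, -1), (-1, 1, 2), (-1, 1, -2), (0, 1, 5), (1, 1, 2), (-1, 1, 2), (2, 1, 1), (-2, 1, 1),
     (1, 2, 1), (-1, 2, 1), (0, 2, 2), (0, 2, 0), (0, 1, -5), (1, 1, -2), (-1, 1, -2), (2, 1,
     -1), (-2, 1, -1), (1, 2, -1), (-1, 2, -1), (0, 2, 0), (0, 2, -2)]"
  and "words 8 CFwd CFwd =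
    [(0, 0, 8), (0, 1, 5), (0, 1, 5), (1, 0, 3), (-1, 0, 3), (0, 1, 5), (2, 0, 2), (1, 1, 2),
     (1, 0, 3), (-2, 0, 2), (-1, 1, 2), (-1, 0, 3), (1, 1, 2), (-1, 1, 2), (0, 1, 5), (3, 0,
     1), (2, 1, 1), (2, 0, 2), (1, 1, 2), (1, 0, 3), (-3, 0, 1), (-2, 1, 1), (-2, 0, 2), (-1,
     1, 2), (-1, 0, 3), (2, 1, 1), (1, 2, 1), (1, 1, 2), (-2, 1, 1), (-1, 2, 1), (-1, 1, 2),
     (0, 1, 5), (0, 2, 2), (0, 2, 0)]"
  by code_simp+

text \<open>The bound leaves the multiples \<open>2 * h * q\<close> with \<open>q\<close> between -3
  and 3. It suits words of length 8 because \<open>k < h\<close>; for instance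
  \<open>(0, 0, 8)\<close> has value \<open>8 * k\<close>.\<close>

lemma dvd_small:
  fixes x h :: int
  assumes "0 < h" "\<bar>x\<bar> < 8 * h"
  shows "2 * h dvd x \<longleftrightarrow> x = 0 \<or> \<bar>x\<bar> = 2 * h \<or> \<bar>x\<bar> = 4 * h \<or> \<bar>x\<bar> = 6 * h"
proof
  assume "2 * h dvd x"
  then obtain q where q: "x = h * (2 * q)" by (metis dvd_def mult.assoc mult.left_commute)
  then have "h * \<bar>2 * q\<bar> < h * 8" using assms by (simp add: abs_mult)
  then have "\<bar>2 * q\<bar> < 8" using assms(1) mult_less_cancel_left_pos by blast
  then have "q \<in> {-3, -2, -1, 0, 1, 2, 3}" by auto
  then show "x = 0 \<or> \<bar>x\<bar> = 2 * h \<or> \<bar>x\<bar> = 4 * h \<or> \<bar>x\<bar> = 6 * h"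
    using q assms(1) by auto
next
  assume "x = 0 \<or> \<bar>x\<bar> = 2 * h \<or> \<bar>x\<bar> = 4 * h \<or> \<bar>x\<bar> = 6 * h"
  moreover have "2 * h dvd 4 * h" "2 * h dvd 6 * h"
    using dvd_triv_left[of "2 * h" 2] dvd_triv_left[of "2 * h" 3] by simp_all
  ultimately have "2 * h dvd \<bar>x\<bar>" by (metis dvd_0_right dvd_refl abs_zero)
  then show "2 * h dvd x" by simp
qed

lemma equal_counts_imp:
  fixes h k :: int and N :: "dart \<Rightarrow> nat"
  assumes h: "2 \<le> h" and k: "1 \<le> k" "k < h"
    and N: "\<And>d. N d = (\<Sum>(a, b, c)\<leftarrow>words 8 d d. of_bool (2 * h dvd a + b * h + c * k))"
    and eq: "N BtoB = N AFwd" "N BtoB = N CFwd"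
  shows "h = 5 \<and> k = 3"
\<comment> \<open>From 6 on, \<open>(5, 1, 0)\<close> no longer closes, which it does for
  \<open>h = 5\<close>, and the closing conditions become uniform in \<open>h\<close>.\<close>
proof (cases "6 \<le> h")
  case True
  define P where "P a b c \<longleftrightarrow> 2 * h dvd a + b * h + c * k" for a b c :: int
  have P: "P a b c \<longleftrightarrow> a + b * h + c * k \<in> {0, 2 * h, - 2 * h, 4 * h, - 4 * h, 6 * h, - 6 * h}"
    if "\<bar>a + b * h + c * k\<bar> < 8 * h" for a b c
    using dvd_small[of h "a + b * h + c * k"] that h unfolding P_def by auto
  \<comment> \<open>All triples occurring in the three lists are resolved here into linear
    conditions on \<open>h\<close> and \<open>k\<close>.\<close>
  have small:
    "P (-5) 1 0 \<longleftrightarrow> False"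
    "P (-3) 0 1 \<longleftrightarrow> k = 3"
    "P (-2) 0 2 \<longleftrightarrow> k = 1"
    "P (-2) 1 (-1) \<longleftrightarrow> k = h - 2"
    "P (-2) 1 1 \<longleftrightarrow> False"
    "P (-2) 2 0 \<longleftrightarrow> False"
    "P (-1) 0 3 \<longleftrightarrow> 3 * k - 1 = 2 * h"
    "P (-1) 1 (-2) \<longleftrightarrow> 2 * k = h - 1"
    "P (-1) 1 2 \<longleftrightarrow> 2 * k = h + 1"
    "P (-1) 2 (-1) \<longleftrightarrow> False"
    "P (-1) 2 1 \<longleftrightarrow> k = 1"
    "P 0 0 8 \<longleftrightarrow> 4 * k = h \<or> 2 * k = h \<or> 4 * k = 3 * h"
    "P 0 1 (-5) \<longleftrightarrow> 5 * k = h \<or> 5 * k = 3 * h"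
    "P 0 1 5 \<longleftrightarrow> 5 * k = h \<or> 5 * k = 3 * h"
    "P 0 2 (-2) \<longleftrightarrow> False"
    "P 0 2 0 \<longleftrightarrow> True"
    "P 0 2 2 \<longleftrightarrow> False"
    "P 1 0 (-3) \<longleftrightarrow> 3 * k - 1 = 2 * h"
    "P 1 0 3 \<longleftrightarrow> 3 * k + 1 = 2 * h"
    "P 1 1 (-2) \<longleftrightarrow> 2 * k = h + 1"
    "P 1 1 2 \<longleftrightarrow> 2 * k = h - 1"
    "P 1 2 (-1) \<longleftrightarrow> k = 1"
    "P 1 2 1 \<longleftrightarrow> False"
    "P 2 0 (-2) \<longleftrightarrow> k = 1"
    "P 2 0 2 \<longleftrightarrow> k = h - 1"
    "P 2 1 (-1) \<longleftrightarrow> False"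
    "P 2 1 1 \<longleftrightarrow> k = h - 2"
    "P 2 2 0 \<longleftrightarrow> False"
    "P 3 0 (-1) \<longleftrightarrow> k = 3"
    "P 3 0 1 \<longleftrightarrow> False"
    "P 5 1 0 \<longleftrightarrow> False"
    "P 8 0 0 \<longleftrightarrow> False"
    using True k by - (subst P; auto)+
  have N': "N d = (\<Sum>(a, b, c)\<leftarrow>words 8 d d. of_bool (P a b c))" for d
    unfolding N P_def ..
  have "k = 3"
  proof (rule ccontr)
    assume "k \<noteq> 3"
    \<comment> \<open>The always closing words put \<open>BtoB\<close> ahead by 3. Apart from
      \<open>k = 3\<close>, only the three conditions split on favour \<open>AFwd\<close>, by 2, 1
      and 1 words; they exclude each other for \<open>h >= 6\<close>, so \<open>BtoB\<close> stays
      ahead.\<close>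
    then have "N AFwd < N BtoB"
      using True k by (cases "k = h - 1"; cases "3 * k + 1 = 2 * h"; cases "3 * k - 1 = 2 * h")
        (simp_all add: N' words_8 small)
    then show False using eq(1) by simp
  qed
  \<comment> \<open>For \<open>k = 3\<close> the counts for \<open>BtoB\<close> and
    \<open>CFwd\<close> are 4 and 2, except at the four values of \<open>h\<close> split on, where
    further words close; the counts differ there too. Hence no solution has
    \<open>h >= 6\<close>.\<close>
  then show ?thesis
    using eq(2) True by (cases "h = 6"; cases "h = 7"; cases "h = 12"; cases "h = 15")
      (simp_all add: N' words_8 small)
next
  case False
  \<comment> \<open>Finitely many pairs remain, and the counts are evaluated for each.\<close>
  then have "h \<in> {2, 3, 4, 5}" "k \<in> {1, 2, 3, 4}" using h k by auto
  then show ?thesis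
    using eq k by (auto simp: N words_8)
qed

lemma edge_transitive_TC_imp:
  assumes n: "3 \<le> n" "even n" "1 \<le> k" "2 * k < n"
    and tr: "edge_transitive (TC_verts n) (TC_edges n k)"
  shows "n = 10 \<and> k = 3"
proof -
  have n0: "0 < n" using n by simp
  define h where "h = int (n div 2)"
  have h: "int n = 2 * h" using n(2) by (auto simp: h_def)
  define N :: "dart \<Rightarrow> nat" where
    "N d = (\<Sum>(a, b, c)\<leftarrow>words 8 d d. of_bool (2 * h dvd a + b * h + c * int k))" for d
  have N: "nb_walks (TC_verts n) (TC_edges n k) 8
      (dart_tail n k d x) (dart_head n d x) (dart_tail n k d x) (dart_head n d x) = N d" for d x
  proof -
    have "(\<lambda>s. of_bool (int n dvd x + shift_value n k s - x) :: nat)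
        = (\<lambda>(a, b, c). of_bool (2 * h dvd a + b * h + c * int k))"
      by (auto simp: h h_def[symmetric])
    then show ?thesis by (simp only: nb_walks_TC[OF n] N_def)
  qed
  have B: "{vB n (- h), vB n 0} \<in> TC_edges n k"
    by (simp add: TC_adjacency[OF n0 n(2)] h_def)
  \<comment> \<open>As \<open>h\<close> and \<open>-h\<close> agree modulo \<open>n\<close>, the
    reversed edge is again a lift of \<open>BtoB\<close>. Both alternatives of the invariance lemma
    therefore give the same count.\<close>
  have rev: "vB n h = vB n (- h)" by (simp add: vABC_eq_iff[OF n0] h)
  have eq: "N BtoB = N d"
    if e: "{dart_tail n k d 0, dart_head n d 0} \<in> TC_edges n k"
      and v: "dart_tail n k d 0 \<in> TC_verts n" "dart_head n d 0 \<in> TC_verts n" for d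
    using edge_transitive_nb_walks[OF tr e B v, of 8] N[of d 0] N[of BtoB 0] N[of BtoB h] rev
    by (simp add: h_def[symmetric])
  have "N BtoB = N AFwd" "N BtoB = N CFwd"
    by (rule eq; simp add: TC_adjacency[OF n0 n(2)] vABC_in_verts[OF n0])+
  then have "h = 5 \<and> int k = 3"
    using equal_counts_imp[OF _ _ _ N_def] n h by simp
  then show ?thesis using h by simp
qed

section \<open>The Tutte--Coxeter graph\<close>

lemma finite_graph_automorphismI:
  assumes V: "finite V" and E: "\<And>e. e \<in> E \<Longrightarrow> e \<subseteq> V" and bij: "bij_betw f V V"
    and f: "\<And>e. e \<in> E \<Longrightarrow> f ` e \<in> E"
  shows "graph_automorphism V E f"
proof -
  \<comment> \<open>An injective map of the finite edge set into itself is onto, so edges are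
    reflected as well as preserved.\<close>
  have "finite E" using finite_subset[of E "Pow V"] V E by auto
  moreover have inj: "inj_on ((`) f) (Pow V)"
    using bij by (simp add: bij_betw_def inj_on_image_Pow)
  then have "inj_on ((`) f) E" by (rule inj_on_subset) (use E in blast)
  ultimately have E': "(`) f ` E = E"
    using f by (intro endo_inj_surj) auto
  have "{u, v} \<in> E" if uv: "u \<in> V" "v \<in> V" "{f u, f v} \<in> E" for u v
  proof -
    obtain e where e: "e \<in> E" "f ` {u, v} = f ` e" using uv(3) E' by (auto simp: image_iff)
    then have "{u, v} = e" using inj_onD[OF inj, of "{u, v}" e] uv E by auto
    then show ?thesis using e by simp
  qed
  then show ?thesis using bij f[of "{_, _}"] by (auto simp: graph_automorphism_def)
qed

lemma graph_automorphism_comp: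
  assumes "graph_automorphism V E f" "graph_automorphism V E g"
  shows "graph_automorphism V E (g \<circ> f)"
proof -
  have "f u \<in> V" if "u \<in> V" for u
    using assms(1) that by (auto simp: graph_automorphism_def bij_betw_def)
  then show ?thesis
    using assms bij_betw_trans[of f V V g V] unfolding graph_automorphism_def comp_def by metis
qed

lemma graph_automorphism_inv:
  assumes f: "graph_automorphism V E f"
  shows "graph_automorphism V E (inv_into V f)"
proof -
  have bij: "bij_betw f V V" using f by (simp add: graph_automorphism_def)
  then have "f (inv_into V f u) = u" "inv_into V f u \<in> V" if "u \<in> V" for u
    using that bij_betw_inv_into_right[OF bij] bij_betwE[OF bij_betw_inv_into[OF bij]] by auto
  then show ?thesis
    using f bij_betw_inv_into[OF bij] unfolding graph_automorphism_def by metis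
qed

lemma edge_transitiveI:
  assumes E: "\<And>e. e \<in> E \<Longrightarrow> e \<subseteq> V"
    and orbit: "\<And>e. e \<in> E \<Longrightarrow> \<exists>f. graph_automorphism V E f \<and> f ` e0 = e"
    and "e0 \<in> E"
  shows "edge_transitive V E"
  unfolding edge_transitive_def
proof (intro ballI)
  fix e e' assume ee: "e \<in> E" "e' \<in> E"
  obtain f g where f: "graph_automorphism V E f" "f ` e0 = e"
    and g: "graph_automorphism V E g" "g ` e0 = e'" using orbit ee by meson
  \<comment> \<open>The map from \<open>e\<close> to \<open>e'\<close> passes through the base edge
    \<open>e0\<close>.\<close>
  have "inv_into V f ` e = e0"
    using f E[OF \<open>e0 \<in> E\<close>] by (auto simp: graph_automorphism_def bij_betw_def image_iff subset_iff
        inv_into_f_f[of f V])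
  then have "(g \<circ> inv_into V f) ` e = e'" using g by (metis image_comp)
  then show "\<exists>f. graph_automorphism V E f \<and> f ` e = e'"
    using graph_automorphism_comp[OF graph_automorphism_inv[OF f(1)] g(1)] by blast
qed

section \<open>Explicit automorphisms of TC(10,3)\<close>

definition verts10 :: "tc_vertex list" where
  "verts10 = map A [0..<10] @ map B [0..<10] @ map C [0..<10]"

definition edges10 :: "(tc_vertex \<times> tc_vertex) list" where
  "edges10 = map (\<lambda>i. (A i, A ((i + 1) mod 10))) [0..<10] @ map (\<lambda>i. (A i, B i)) [0..<10] @
    map (\<lambda>i. (B i, B ((i + 5) mod 10))) [0..<10] @ map (\<lambda>i. (B i, C i)) [0..<10] @
    map (\<lambda>i. (C i, C ((i + 3) mod 10))) [0..<10]"

lemma TC_verts_10: "TC_verts 10 = set verts10"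
  by (auto simp: TC_verts_def verts10_def)

lemma TC_edges_10: "TC_edges 10 3 = (\<lambda>(u, v). {u, v}) ` set edges10"
proof -
  have s: "{h i |i::nat. i < 10} = h ` {0..<10}" for h :: "nat \<Rightarrow> tc_vertex set" by auto
  have "(10::nat) div 2 = 5" by simp
  then show ?thesis
    by (simp only: TC_edges_def s edges10_def set_append set_map set_upt image_Un image_image
        prod.case Un_assoc)
qed

lemma edges10_verts10: "list_all (\<lambda>(u, v). u \<in> set verts10 \<and> v \<in> set verts10) edges10"
  by code_simp

text \<open>The hypotheses are list checks decidable by evaluation. Images are sought in both orders
  because \<open>edges10\<close> stores edges as ordered pairs.\<close>

lemma automorphism_10:
  assumes "distinct (map f verts10)" "list_all (\<lambda>v. f v \<in> set verts10) verts10"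
    and "list_all (\<lambda>(u, v). (f u, f v) \<in> set edges10 \<or> (f v, f u) \<in> set edges10) edges10"
  shows "graph_automorphism (TC_verts 10) (TC_edges 10 3) f"
proof (rule finite_graph_automorphismI)
  show "finite (TC_verts 10)" by (simp add: TC_verts_10)
  show "e \<subseteq> TC_verts 10" if "e \<in> TC_edges 10 3" for e
    using that edges10_verts10 by (auto simp: TC_verts_10 TC_edges_10 list_all_iff)
  have "inj_on f (TC_verts 10)" using assms(1) by (simp add: TC_verts_10 distinct_map)
  moreover have "f ` TC_verts 10 \<subseteq> TC_verts 10"
    using assms(2) by (auto simp: TC_verts_10 list_all_iff)
  ultimately show "bij_betw f (TC_verts 10) (TC_verts 10)"
    by (simp add: bij_betw_def TC_verts_10 endo_inj_surj)
  show "f ` e \<in> TC_edges 10 3" if e: "e \<in> TC_edges 10 3" for e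
  proof -
    obtain u v where uv: "(u, v) \<in> set edges10" "e = {u, v}"
      using e by (auto simp: TC_edges_10)
    then have "(f u, f v) \<in> set edges10 \<or> (f v, f u) \<in> set edges10"
      using assms(3) by (auto simp: list_all_iff)
    then show ?thesis
      by (auto simp: TC_edges_10 uv(2) image_iff insert_commute intro: bexI[rotated])
  qed
qed

fun rotation10 :: "tc_vertex \<Rightarrow> tc_vertex" where
  "rotation10 (A i) = A ((i + 1) mod 10)"
| "rotation10 (B i) = B ((i + 1) mod 10)"
| "rotation10 (C i) = C ((i + 1) mod 10)"

text \<open>
  The graph is 5-arc-transitive; this automorphism moves the arc \<open>A 1, A 0, B 0, B 5, C 5, C 8\<close>,
  which contains an edge of each of the five families, one step forward.
\<close>

fun arc_shift10 :: "tc_vertex \<Rightarrow> tc_vertex" where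
  "arc_shift10 (A i) = [B 0, A 0, A 9, B 9, C 9, C 2, B 2, B 7, C 7, C 0] ! i"
| "arc_shift10 (B i) = [B 5, A 1, A 8, B 4, C 6, C 5, A 2, A 7, C 4, C 3] ! i"
| "arc_shift10 (C i) = [A 5, B 1, B 8, A 4, B 6, C 8, A 3, A 6, C 1, B 3] ! i"

lemma automorphism_rotation10: "graph_automorphism (TC_verts 10) (TC_edges 10 3) rotation10"
  by (rule automorphism_10; code_simp)

lemma automorphism_arc_shift10: "graph_automorphism (TC_verts 10) (TC_edges 10 3) arc_shift10"
  by (rule automorphism_10; code_simp)

lemma edge_transitive_TC_10_3: "edge_transitive (TC_verts 10) (TC_edges 10 3)"
proof (rule edge_transitiveI)
  define R where
    "R e \<longleftrightarrow> (\<exists>f. graph_automorphism (TC_verts 10) (TC_edges 10 3) f \<and> f ` {A 1, A 0} = e)" for e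
  have step: "R (g ` e)" if "R e" "graph_automorphism (TC_verts 10) (TC_edges 10 3) g" for g e
  proof -
    obtain f where f: "graph_automorphism (TC_verts 10) (TC_edges 10 3) f" "f ` {A 1, A 0} = e"
      using \<open>R e\<close> unfolding R_def by blast
    then have "(g \<circ> f) ` {A 1, A 0} = g ` e" by (simp only: image_comp[symmetric])
    then show ?thesis using graph_automorphism_comp[OF f(1) that(2)] unfolding R_def by blast
  qed
  have shift: "R {arc_shift10 u, arc_shift10 v}" if "R {u, v}" for u v
    using step[OF that automorphism_arc_shift10] by (simp only: image_insert image_empty)
  have rot: "R {rotation10 u, rotation10 v}" if "R {u, v}" for u v
    using step[OF that automorphism_rotation10] by (simp only: image_insert image_empty)
  \<comment> \<open>Five consecutive edges of the arc, one per family, are reached from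
    \<open>{A 1, A 0}\<close> by repeating \<open>arc_shift10\<close>.\<close>
  have r1: "R {A 1, A 0}"
    unfolding R_def by (intro exI[of _ id]) (simp add: graph_automorphism_def)
  have r2: "R {A 0, B 0}" using shift[OF r1] by simp
  have r3: "R {B 0, B 5}" using shift[OF r2] by simp
  have r4: "R {B 5, C 5}" using shift[OF r3] by simp
  have r5: "R {C 5, C 8}" using shift[OF r4] by simp
  \<comment> \<open>Rotating \<open>m\<close> times adds \<open>m\<close> to both indices, so one
    edge of a family brings in the whole family.\<close>
  have rotated: "R {f ((i + m) mod 10), g ((j + m) mod 10)}"
    if "R {f (i mod 10), g (j mod 10)}" "\<And>i. rotation10 (f i) = f ((i + 1) mod 10)"
      "\<And>i. rotation10 (g i) = g ((i + 1) mod 10)" for f g :: "nat \<Rightarrow> tc_vertex" and i j m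
  proof (induction m)
    case 0
    then show ?case using that(1) by simp
  next
    case (Suc m)
    then show ?case using rot[OF Suc] by (simp add: that(2,3) mod_Suc_eq)
  qed
  show "\<exists>f. graph_automorphism (TC_verts 10) (TC_edges 10 3) f \<and> f ` {A 1, A 0} = e"
    if e: "e \<in> TC_edges 10 3" for e
  proof -
    have "R {A i, A ((i + 1) mod 10)}" "R {A i, B i}" "R {B i, B ((i + 5) mod 10)}" "R {B i, C i}"
      "R {C i, C ((i + 3) mod 10)}" if "i < 10" for i
      \<comment> \<open>The representatives of the last two families start at index 5, so rotation
        by \<open>i + 5\<close> brings them to index \<open>i\<close> modulo 10.\<close>
      using that rotated[of A 1 A 0 i] rotated[of A 0 B 0 i] rotated[of B 0 B 5 i]
        rotated[of B 5 C 5 "i + 5"] rotated[of C 5 C 8 "i + 5"] mod_add_self2[of "i + 3" 10]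
        r1 r2 r3 r4 r5
      by (simp_all add: insert_commute add.commute)
    moreover have "(10::nat) div 2 = 5" by simp
    ultimately have "R e" using e unfolding TC_edges_def by auto
    then show ?thesis by (simp add: R_def)
  qed
  show "e \<subseteq> TC_verts 10" if "e \<in> TC_edges 10 3" for e
    using that edges10_verts10 by (auto simp: TC_verts_10 TC_edges_10 list_all_iff)
  show "{A 1, A 0} \<in> TC_edges 10 3"
    unfolding TC_edges_def by (intro UnI1 CollectI exI[of _ 0]) auto
qed

theorem theorem2p2:
  fixes n k :: nat
  assumes "n \<ge> 3" and "even n" and "1 \<le> k" and "2 * k < n"
  shows "edge_transitive (TC_verts n) (TC_edges n k) \<longleftrightarrow> (n, k) = (10, 3)"
  using edge_transitive_TC_imp[OF assms] edge_transitive_TC_10_3 by auto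

end
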